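(* If $\mathfrak{s} \leq \mathfrak{a}$, then there is a completely separable maximal almost disjoint family $\mathcal{A} \subset [\omega]^{\omega}$.
   Context: $\mathcal{P}(\omega)$ is the power set of $\omega$ and $[\omega]^{\omega}$ is the set of infinite subsets of $\omega$; $a \subset^{*} b$ means that $a \setminus b$ is finite. Two infinite subsets $a, b$ of $\omega$ are almost disjoint (a.d.) if $a \cap b$ is finite. A family $\mathcal{A}$ of infinite subsets of $\omega$ is almost disjoint (a.d.) if its members are pairwise almost disjoint. A maximal almost disjoint (MAD) family is an infinite a.d. family that is not properly contained in a larger a.d. family. For an a.d. family $\mathcal{A}$, $\mathcal{I}(\mathcal{A})$ is the ideal on $\omega$ generated by $\mathcal{A}$: $a \in \mathcal{I}(\mathcal{A})$ iff there are $a_0, \dots, a_k \in \mathcal{A}$ with $a \subset^{*} a_0 \cup \dots \cup a_k$. Put $\mathcal{I}^{+}(\mathcal{A}) = \mathcal{P}(\omega) \setminus \mathcal{I}(\mathcal{A})$. An a.d. family $\mathcal{A} \subset [\omega]^{\omega}$ is completely separable if for every $b \in \mathcal{I}^{+}(\mathcal{A})$ there is $a \in \mathcal{A}$ with $a \subset b$. Cardinal invariants: $\mathfrak{a}$ is the least cardinality of a MAD family. A set $x \subset \omega$ splits $a \subset \omega$ if both $a \cap x$ and $a \setminus x$ are infinite; $\mathcal{F} \subset \mathcal{P}(\omega)$ is a splitting family if every $a \in [\omega]^{\omega}$ is split by some $x \in \mathcal{F}$; $\mathfrak{s}$ is the least cardinality of a splitting family. The ambient theory is ZFC. *)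

theory Defs
  imports Main "HOL-Library.Infinite_Set" "HOL-Library.Nat_Bijection"
begin

unbundle cardinal_syntax

definition infinite_subsets :: "nat set set" where
  "infinite_subsets = {a. infinite a}"

definition almost_subset :: "nat set \<Rightarrow> nat set \<Rightarrow> bool"  (infix "\<subseteq>\<^sup>*" 50) where
  "a \<subseteq>\<^sup>* b \<longleftrightarrow> finite (a - b)"

definition almost_disjoint :: "nat set \<Rightarrow> nat set \<Rightarrow> bool" where
  "almost_disjoint a b \<longleftrightarrow> finite (a \<inter> b)"

definition ad_family :: "nat set set \<Rightarrow> bool" where
  "ad_family A \<longleftrightarrow> A \<subseteq> infinite_subsets \<and> pairwise almost_disjoint A"

definition mad_family :: "nat set set \<Rightarrow> bool" where
  "mad_family A \<longleftrightarrow> infinite A \<and> ad_family A \<and> \<not> (\<exists>B. ad_family B \<and> A \<subset> B)"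

definition ad_ideal :: "nat set set \<Rightarrow> nat set set" where
  "ad_ideal A = {a. \<exists>F. finite F \<and> F \<noteq> {} \<and> F \<subseteq> A \<and> a \<subseteq>\<^sup>* \<Union>F}"

definition ad_positive :: "nat set set \<Rightarrow> nat set set" where
  "ad_positive A = Pow UNIV - ad_ideal A"

definition completely_separable :: "nat set set \<Rightarrow> bool" where
  "completely_separable A \<longleftrightarrow> ad_family A \<and> (\<forall>b \<in> ad_positive A. \<exists>a \<in> A. a \<subseteq> b)"

definition splits :: "nat set \<Rightarrow> nat set \<Rightarrow> bool" where
  "splits x a \<longleftrightarrow> infinite (a \<inter> x) \<and> infinite (a - x)"

definition splitting_family :: "nat set set \<Rightarrow> bool" where
  "splitting_family F \<longleftrightarrow> (\<forall>a \<in> infinite_subsets. \<exists>x \<in> F. splits x a)"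

(* The least cardinality of a set satisfying P, as a cardinal in the sense of the HOL
   cardinal library: the choice is unique up to =o, and it is meaningful only if some set
   satisfies P. Both instances used below satisfy this, see splitting_family_Pow and
   mad_family_exists. *)
definition least_card :: "('a set \<Rightarrow> bool) \<Rightarrow> 'a rel" where
  "least_card P = |SOME F. P F \<and> (\<forall>G. P G \<longrightarrow> |F| \<le>o |G| )|"

definition splitting_number :: "nat set rel"  ("\<ss>") where
  "\<ss> = least_card splitting_family"

definition ad_number :: "nat set rel"  ("\<aa>") where
  "\<aa> = least_card mad_family"

lemma least_card:
  assumes "P F"
  shows "\<exists>G. P G \<and> least_card P = |G|" and "P H \<Longrightarrow> least_card P \<le>o |H|"
proof -
  have "\<exists>r \<in> card_of ` Collect P. \<forall>r' \<in> card_of ` Collect P. r \<le>o r'"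
    by (rule exists_minim_Card_order) (use assms card_of_Card_order in blast)+
  then have "\<exists>F. P F \<and> (\<forall>G. P G \<longrightarrow> |F| \<le>o |G| )"
    by blast
  from someI_ex[OF this]
  show "\<exists>G. P G \<and> least_card P = |G|" and "P H \<Longrightarrow> least_card P \<le>o |H|"
    unfolding least_card_def by blast+
qed

lemma splitting_family_Pow: "splitting_family (Pow UNIV)"
proof -
  have "\<exists>x. splits x a" if a: "infinite a" for a :: "nat set"
  proof -
    have inj: "enumerate a m = enumerate a n \<longleftrightarrow> m = n" for m n
      using strict_mono_eq[OF strict_mono_enumerate[OF a]] .
    define x where "x = range (\<lambda>n. enumerate a (2 * n))"
    define y where "y = range (\<lambda>n. enumerate a (2 * n + 1))"
    have "infinite x" "infinite y"
      unfolding x_def y_def by (auto intro!: range_inj_infinite simp: inj_def inj)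
    moreover have "x \<subseteq> a"
      unfolding x_def using enumerate_in_set[OF a] by blast
    then have "a \<inter> x = x"
      by blast
    moreover have "y \<subseteq> a - x"
    proof
      fix k assume "k \<in> y"
      then obtain n where k: "k = enumerate a (2 * n + 1)"
        by (auto simp: y_def)
      have "2 * n + 1 \<noteq> 2 * m" for m
        by presburger
      then show "k \<in> a - x"
        using enumerate_in_set[OF a] by (auto simp only: k x_def inj)
    qed
    ultimately show ?thesis
      unfolding splits_def by (metis finite_subset)
  qed
  then show ?thesis
    by (auto simp: splitting_family_def infinite_subsets_def)
qed

lemma mad_family_exists: "\<exists>A. mad_family A"
proof -
  define C where "C = (\<lambda>n. range (\<lambda>m. prod_encode (n, m)))"
  have infC: "infinite (C n)" for n
    unfolding C_def by (rule range_inj_infinite) (auto simp: inj_def)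
  have disjC: "C m \<inter> C n = {}" if "m \<noteq> n" for m n
    using that by (auto simp: C_def)
  have "inj C"
    using disjC infC by (metis finite.emptyI inf.idem injI)
  then have inf_range: "infinite (range C)"
    by (rule range_inj_infinite)
  have "almost_disjoint (C m) (C n)" if "C m \<noteq> C n" for m n
    using disjC[of m n] that by (cases "m = n") (auto simp: almost_disjoint_def)
  then have adC: "ad_family (range C)"
    using infC by (auto simp: ad_family_def infinite_subsets_def pairwise_def)
  define S where "S = {B. ad_family B \<and> range C \<subseteq> B}"
  have "\<exists>M\<in>S. \<forall>X\<in>S. M \<subseteq> X \<longrightarrow> X = M"
  proof (rule subset_Zorn_nonempty)
    show "S \<noteq> {}"
      using adC by (auto simp: S_def)
  next
    fix K assume K: "K \<noteq> {}" "subset.chain S K"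
    then have KS: "K \<subseteq> S" and lin: "\<And>X Y. X \<in> K \<Longrightarrow> Y \<in> K \<Longrightarrow> X \<subseteq> Y \<or> Y \<subseteq> X"
      by (auto simp: subset_chain_def)
    have "almost_disjoint a b" if ab: "a \<in> \<Union>K" "b \<in> \<Union>K" "a \<noteq> b" for a b
    proof -
      obtain X where "X \<in> K" "a \<in> X" "b \<in> X"
        using ab lin by blast
      then show ?thesis
        using KS ab(3) by (auto simp: S_def ad_family_def pairwise_def)
    qed
    moreover have "\<Union>K \<subseteq> infinite_subsets"
      using KS by (auto simp: S_def ad_family_def)
    moreover have "range C \<subseteq> \<Union>K"
      using K(1) KS by (auto simp: S_def)
    ultimately show "\<Union>K \<in> S"
      by (simp add: S_def ad_family_def pairwise_def)
  qed
  then obtain M where "M \<in> S" and max: "\<And>X. X \<in> S \<Longrightarrow> M \<subseteq> X \<Longrightarrow> X = M"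
    by blast
  then have "ad_family M" "range C \<subseteq> M"
    by (auto simp: S_def)
  moreover have "infinite M"
    using inf_range \<open>range C \<subseteq> M\<close> finite_subset by blast
  moreover have "\<not> (\<exists>B. ad_family B \<and> M \<subset> B)"
    using max \<open>range C \<subseteq> M\<close> by (auto simp: S_def)
  ultimately show ?thesis
    by (auto simp: mad_family_def)
qed

end

theory Submission
  imports Defs
begin

text \<open>
  Combining a splitting family with an unbounded family of interval partitions extracted from a MAD
  family gives a family \<open>F\<close> of size at most \<open>\<aa>\<close> such that any countably many infinite sets are
  simultaneously split by one member of \<open>F\<close>. Hence every positive set is split into two positive sets
  by a member of \<open>F\<close>, and iterating this, with positive pseudo-intersections at the limit, yields
  continuum many positive subsets of \<open>b\<close> which follow pairwise incompatible branches through the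
  binary tree over \<open>F\<close>. In a recursion of length continuum one can thus choose inside a positive \<open>b\<close> a
  positive set \<open>c\<close> with a branch \<open>\<eta>\<close> not extended by any earlier branch. Earlier sets with a branch
  incompatible to \<open>\<eta>\<close> are harmless. The others have proper initial segments of \<open>\<eta>\<close> as branches, so
  there are fewer than \<open>|F| \<le> \<aa>\<close> of them; the sets needed to force \<open>c\<close> almost to the side \<open>\<eta>\<close> at each
  level are equally few. Therefore some infinite \<open>a \<subseteq> c\<close> is almost disjoint from all of them.
\<close>

section \<open>Omega-splitting families of size at most \<open>\<aa>\<close>\<close>

definition omega_splitting :: "nat set set \<Rightarrow> bool" where
  "omega_splitting F \<longleftrightarrow> (\<forall>e :: nat \<Rightarrow> nat set. (\<forall>n. infinite (e n)) \<longrightarrow> (\<exists>x\<in>F. \<forall>n. splits x (e n)))"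

lemma mad_family_infinite_Int:
  assumes "mad_family M" "infinite d"
  shows "\<exists>a\<in>M. infinite (a \<inter> d)"
proof (rule ccontr)
  assume no: "\<not> ?thesis"
  then have "d \<notin> M"
    using assms(2) by auto
  moreover have "ad_family (insert d M)"
    using assms no by (auto simp: mad_family_def ad_family_def pairwise_def infinite_subsets_def
        almost_disjoint_def Int_commute)
  ultimately show False
    using assms(1) by (auto simp: mad_family_def)
qed

text \<open>This is the inequality \<open>\<bb> \<le> \<aa>\<close>.\<close>

lemma mad_family_unbounded:
  assumes M: "mad_family M"
  shows "\<exists>f :: nat set \<Rightarrow> nat \<Rightarrow> nat. (\<forall>a\<in>M. mono (f a) \<and> (\<forall>n. n < f a n))
    \<and> (\<forall>g. \<exists>a\<in>M. infinite {n. g n < f a n})"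
proof -
  have ad: "finite (a \<inter> b)" if "a \<in> M" "b \<in> M" "a \<noteq> b" for a b
    using M that by (auto simp: mad_family_def ad_family_def pairwise_def almost_disjoint_def)
  have infM: "infinite a" if "a \<in> M" for a
    using M that by (auto simp: mad_family_def ad_family_def infinite_subsets_def)
  obtain c :: "nat \<Rightarrow> nat set" where c: "inj c" "range c \<subseteq> M"
    using M infinite_countable_subset[of M] unfolding mad_family_def by blast
  \<comment> \<open>\<open>f a n\<close> lies above \<open>n\<close> and above every point that
    \<open>a\<close> shares with some other \<open>c i\<close>, \<open>i \<le> n\<close>. Leaving
    out \<open>c i = a\<close> keeps the set under \<open>Max\<close> finite.\<close>
  define f where "f = (\<lambda>a n. Suc (Max (insert n (\<Union>i\<in>{i. i \<le> n \<and> c i \<noteq> a}. a \<inter> c i))))"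
  have fin: "finite (\<Union>i\<in>{i. i \<le> n \<and> c i \<noteq> a}. a \<inter> c i)" if "a \<in> M" for a n
    using that c(2) by (intro finite_UN_I) (auto intro!: ad)
  have mono: "mono (f a)" if "a \<in> M" for a
  proof (rule monoI)
    fix m n :: nat assume "m \<le> n"
    define U where "U k = (\<Union>i\<in>{i. i \<le> k \<and> c i \<noteq> a}. a \<inter> c i)" for k
    have U: "finite (U k)" for k
      unfolding U_def using fin[OF that] .
    have "U m \<subseteq> U n"
      unfolding U_def using \<open>m \<le> n\<close> by (intro UN_mono) auto
    then have "x \<le> Max (insert n (U n))" if "x \<in> insert m (U m)" for x
      using that \<open>m \<le> n\<close> U by (auto simp: le_max_iff_disj Max_ge_iff)
    then have "Max (insert m (U m)) \<le> Max (insert n (U n))"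
      using U by (intro Max.boundedI) auto
    then show "f a m \<le> f a n"
      by (simp add: f_def U_def)
  qed
  have gt: "n < f a n" if "a \<in> M" for a n
    using fin[OF that] by (simp add: f_def less_Suc_eq_le)
  have "\<exists>a\<in>M. infinite {n. g n < f a n}" for g
  proof -
    \<comment> \<open>Points \<open>p n\<close> of \<open>c n\<close> outside all earlier
      \<open>c i\<close> form a set that meets each \<open>c i\<close> finitely, so a member
      \<open>a\<close> of \<open>M\<close> meeting it infinitely is none of the \<open>c i\<close>.
      Whenever \<open>p n \<in> a\<close>, it follows that \<open>g n < p n < f a n\<close>.\<close>
    have "\<exists>k\<in>c n. (\<forall>i<n. k \<notin> c i) \<and> g n < k \<and> n < k" for n
    proof -
      have "finite (\<Union>i<n. c n \<inter> c i)"
        using c by (intro finite_UN_I) (auto intro!: ad dest: injD)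
      then have "finite ((\<Union>i<n. c n \<inter> c i) \<union> {..g n} \<union> {..n})"
        by simp
      then have "infinite (c n - ((\<Union>i<n. c n \<inter> c i) \<union> {..g n} \<union> {..n}))"
        using infM c(2) by (metis Diff_infinite_finite range_subsetD)
      then obtain k where "k \<in> c n - ((\<Union>i<n. c n \<inter> c i) \<union> {..g n} \<union> {..n})"
        using infinite_imp_nonempty by blast
      then show ?thesis
        by (intro bexI[of _ k]) auto
    qed
    then obtain p where p: "\<And>n. p n \<in> c n" "\<And>n i. i < n \<Longrightarrow> p n \<notin> c i"
        "\<And>n. g n < p n" "\<And>n. n < p n"
      by metis
    have "infinite (range p)"
      unfolding infinite_nat_iff_unbounded using p(4) by blast
    then obtain a where a: "a \<in> M" "infinite (a \<inter> range p)"
      using mad_family_infinite_Int[OF M] by blast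
    have ne: "c i \<noteq> a" for i
    proof
      assume "c i = a"
      then have "n \<le> i" if "p n \<in> a" for n
        using p(2) that by (metis leI)
      then have "a \<inter> range p \<subseteq> p ` {..i}"
        by blast
      then show False
        using a(2) finite_subset by blast
    qed
    have "p n \<in> a \<Longrightarrow> p n < f a n" for n
      unfolding f_def less_Suc_eq_le using p(1) fin[OF a(1)] ne by (intro Max_ge) auto
    then have "a \<inter> range p \<subseteq> p ` {n. g n < f a n}"
      using p(3) by (fastforce intro: less_trans)
    then show ?thesis
      using a by (metis finite_imageI finite_subset)
  qed
  then show ?thesis
    using mono gt by (intro exI[of _ f]) auto
qed

text \<open>The union of the blocks of the interval partition \<open>0 < f 0 < f (f 0) < \<dots>\<close> with index in \<open>x\<close>.\<close>

definition block_union :: "(nat \<Rightarrow> nat) \<Rightarrow> nat set \<Rightarrow> nat set" where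
  "block_union f x = (\<Union>k\<in>x. {(f ^^ k) 0..<(f ^^ Suc k) 0})"

text \<open>Both \<open>x\<close> and its complement contain infinitely many indices from
  \<open>D\<close>. As the blocks are disjoint and move off to infinity, \<open>e n\<close> has
  infinitely many points on either side.\<close>

lemma block_union_splits:
  assumes f: "mono f" "\<And>n. n < f n"
    and D: "splits x D" "\<And>n k. k \<in> D \<Longrightarrow> n \<le> k \<Longrightarrow> \<exists>m\<in>e n. m \<in> {(f ^^ k) 0..<(f ^^ Suc k) 0}"
  shows "splits (block_union f x) (e n)"
proof -
  have sm: "strict_mono (\<lambda>k. (f ^^ k) 0)"
    using f(2) by (intro strict_mono_Suc_iff[THEN iffD2]) simp
  have ge: "k \<le> (f ^^ k) 0" for k
    using strict_mono_imp_increasing[OF sm] by simp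
  have disj: "k = l" if "m \<in> {(f ^^ k) 0..<(f ^^ Suc k) 0}" "m \<in> {(f ^^ l) 0..<(f ^^ Suc l) 0}" for k l m
  proof -
    have "(f ^^ k) 0 < (f ^^ Suc l) 0" "(f ^^ l) 0 < (f ^^ Suc k) 0"
      using that by auto
    then show ?thesis
      using strict_mono_less[OF sm] by (metis less_antisym not_less_eq)
  qed
  have inf: "infinite (e n \<inter> block_union f y)" if y: "infinite (D \<inter> y)" for y
    unfolding infinite_nat_iff_unbounded_le
  proof
    fix N
    obtain k where k: "k \<in> D \<inter> y" "max n N \<le> k"
      using y unfolding infinite_nat_iff_unbounded_le by blast
    then obtain m where "m \<in> e n" "m \<in> {(f ^^ k) 0..<(f ^^ Suc k) 0}"
      using D(2)[of k n] by auto
    moreover from this(2) have "N \<le> m"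
      using ge[of k] k(2) by simp
    ultimately show "\<exists>m\<ge>N. m \<in> e n \<inter> block_union f y"
      using k(1) by (auto simp: block_union_def)
  qed
  have "block_union f x \<inter> block_union f (- x) = {}"
    using disj unfolding block_union_def by blast
  then have "e n \<inter> block_union f (- x) \<subseteq> e n - block_union f x"
    by blast
  then show ?thesis
    using inf[of x] inf[of "- x"] D(1) unfolding splits_def
    by (metis Diff_eq finite_subset)
qed

text \<open>This is the theorem of Kamburelis and Weglorz that the \<open>\<omega>\<close>-splitting number is at most \<open>max \<bb> \<ss>\<close>.\<close>

lemma omega_splitting_block_unions:
  assumes f: "\<And>a. a \<in> M \<Longrightarrow> mono (f a)" "\<And>a n. a \<in> M \<Longrightarrow> n < f a n"
    and unb: "\<And>g. \<exists>a\<in>M. infinite {n. g n < f a n}"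
    and S: "splitting_family S"
  shows "omega_splitting ((\<lambda>(a, x). block_union (f a) x) ` (M \<times> S))"
  unfolding omega_splitting_def
proof (intro allI impI)
  fix e :: "nat \<Rightarrow> nat set" assume e: "\<forall>n. infinite (e n)"
  \<comment> \<open>The interval from \<open>m\<close> to \<open>h m\<close> is long enough to meet
    each of \<open>e 0\<close>, ..., \<open>e m\<close>.\<close>
  have "\<exists>h. m < h \<and> (\<forall>n\<le>m. \<exists>k\<in>e n. m \<le> k \<and> k < h)" for m
  proof -
    have "\<forall>n. \<exists>k. m \<le> k \<and> k \<in> e n"
      using e unfolding infinite_nat_iff_unbounded_le by blast
    then obtain k where k: "\<And>n. m \<le> k n" "\<And>n. k n \<in> e n"
      by metis
    have "k n < Suc (Max (k ` {..m}))" if "n \<le> m" for n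
      using that by (simp add: less_Suc_eq_le)
    moreover have "m < Suc (Max (k ` {..m}))"
      using calculation[of 0] k(1)[of 0] by linarith
    ultimately show ?thesis
      using k by blast
  qed
  then obtain h where h: "\<And>m. m < h m" "\<And>m n. n \<le> m \<Longrightarrow> \<exists>k\<in>e n. m \<le> k \<and> k < h m"
    by metis
  obtain a where a: "a \<in> M" "infinite {n. h (h n) < f a n}"
    using unb[of "\<lambda>n. h (h n)"] by blast
  define E where "E k = (f a ^^ k) 0" for k
  have E_Suc: "E (Suc k) = f a (E k)" for k
    by (simp add: E_def)
  have sm: "strict_mono E"
    using f(2)[OF a(1)] by (intro strict_mono_Suc_iff[THEN iffD2]) (simp add: E_Suc)
  have ge: "k \<le> E k" for k
    using strict_mono_imp_increasing[OF sm] by simp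
  define D where "D = {k. \<forall>n\<le>k. \<exists>m\<in>e n. m \<in> {E k..<E (Suc k)}}"
  have "infinite D"
    unfolding infinite_nat_iff_unbounded_le
  proof
    fix N
    \<comment> \<open>If \<open>m\<close> lies in block \<open>k\<close>, then
      \<open>h (h m) < f a m \<le> E (k + 2)\<close>. Hence either \<open>[m, h m)\<close> fits into
      block \<open>k\<close> or \<open>[h m, h (h m))\<close> fits into block \<open>k + 1\<close>,
      and that block has its index in \<open>D\<close>.\<close>
    obtain m where m: "E N \<le> m" "h (h m) < f a m"
      using a(2) unfolding infinite_nat_iff_unbounded_le by blast
    have "\<exists>k. E k \<le> m \<and> m < E (Suc k)"
    proof -
      have "\<exists>k. m < E k"
        using ge[of "Suc m"] Suc_le_lessD by blast
      then have "m < E (LEAST k. m < E k)"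
        by (rule LeastI_ex)
      moreover have "E 0 \<le> m"
        by (simp add: E_def)
      ultimately have "(LEAST k. m < E k) \<noteq> 0"
        by (metis leD)
      then obtain k where k: "(LEAST k. m < E k) = Suc k"
        using not0_implies_Suc by blast
      then have "\<not> m < E k"
        by (intro not_less_Least) simp
      with k show ?thesis
        using \<open>m < E (LEAST k. m < E k)\<close> by (intro exI[of _ k]) simp
    qed
    then obtain k where k: "E k \<le> m" "m < E (Suc k)"
      by blast
    have "N \<le> k"
      using k(2) m(1) strict_mono_less[OF sm, of N "Suc k"] by simp
    have "f a m \<le> E (Suc (Suc k))"
      using k(2) f(1)[OF a(1)] by (simp add: E_Suc[of "Suc k"] monoD)
    show "\<exists>k\<ge>N. k \<in> D"
    proof (cases "h m \<le> E (Suc k)")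
      case True
      have "k \<in> D"
        unfolding D_def
      proof clarify
        fix n assume "n \<le> k"
        then have "n \<le> m"
          using ge[of k] k(1) by linarith
        with h(2) obtain j where "j \<in> e n" "m \<le> j" "j < h m"
          by blast
        then show "\<exists>m\<in>e n. m \<in> {E k..<E (Suc k)}"
          using True k(1) by (intro bexI[of _ j]) auto
      qed
      then show ?thesis
        using \<open>N \<le> k\<close> by blast
    next
      case False
      have "Suc k \<in> D"
        unfolding D_def
      proof clarify
        fix n assume "n \<le> Suc k"
        then have "n \<le> h m"
          using ge[of "Suc k"] False by linarith
        with h(2) obtain j where "j \<in> e n" "h m \<le> j" "j < h (h m)"
          by blast
        then show "\<exists>m\<in>e n. m \<in> {E (Suc k)..<E (Suc (Suc k))}"
          using False m(2) \<open>f a m \<le> E (Suc (Suc k))\<close> by (intro bexI[of _ j]) auto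
      qed
      then show ?thesis
        using \<open>N \<le> k\<close> le_Suc_eq by blast
    qed
  qed
  then obtain x where x: "x \<in> S" "splits x D"
    using S by (auto simp: splitting_family_def infinite_subsets_def)
  have "splits (block_union (f a) x) (e n)" for n
    using f a(1) x(2) by (intro block_union_splits[where D = D]) (auto simp: D_def E_def)
  then show "\<exists>x\<in>(\<lambda>(a, x). block_union (f a) x) ` (M \<times> S). \<forall>n. splits x (e n)"
    using a(1) x(1) by force
qed

text \<open>The hypothesis \<open>\<ss> \<le>o \<aa>\<close> enters here: a MAD family of size
  \<open>\<aa>\<close> is infinite, so its product with a smallest splitting family still has size
  at most \<open>\<aa>\<close>.\<close>

lemma omega_splitting_le_ad_number:
  assumes "\<ss> \<le>o \<aa>"
  shows "\<exists>F. omega_splitting F \<and> |F| \<le>o \<aa>"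
proof -
  obtain M where M: "mad_family M" "\<aa> = |M|"
    using mad_family_exists least_card(1)[of mad_family] by (auto simp: ad_number_def)
  obtain S where S: "splitting_family S" "\<ss> = |S|"
    using splitting_family_Pow least_card(1)[of splitting_family] by (auto simp: splitting_number_def)
  obtain f :: "nat set \<Rightarrow> nat \<Rightarrow> nat" where f: "\<And>a. a \<in> M \<Longrightarrow> mono (f a)" "\<And>a n. a \<in> M \<Longrightarrow> n < f a n"
    "\<And>g. \<exists>a\<in>M. infinite {n. g n < f a n}"
    using mad_family_unbounded[OF M(1)] by blast
  have "omega_splitting ((\<lambda>(a, x). block_union (f a) x) ` (M \<times> S))"
    using f S(1) by (rule omega_splitting_block_unions)
  moreover have "|M \<times> S| \<le>o |M|"
    using M S assms unfolding M(2) S(2)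
    by (intro card_of_Times_ordLeq_infinite_Field) (auto simp: mad_family_def Field_card_of card_of_card_order_on ordLeq_refl)
  then have "|(\<lambda>(a, x). block_union (f a) x) ` (M \<times> S)| \<le>o \<aa>"
    unfolding M(2) using card_of_image ordLeq_transitive by blast
  ultimately show ?thesis
    by blast
qed

section \<open>Positive sets: splitting, pseudo-intersections, avoiding few members\<close>

text \<open>Positivity with respect to the ideal of \<open>A\<close>. In contrast to \<^const>\<open>ad_positive\<close>, finite sets are not
  positive even if \<open>A\<close> is empty.\<close>

definition pos :: "nat set set \<Rightarrow> nat set \<Rightarrow> bool" where
  "pos A b \<longleftrightarrow> (\<forall>G. finite G \<longrightarrow> G \<subseteq> A \<longrightarrow> infinite (b - \<Union>G))"

lemma pos_infinite: "pos A b \<Longrightarrow> infinite b"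
  unfolding pos_def by (metis Diff_empty Union_empty empty_subsetI finite.emptyI)

lemma pos_antimono: "pos B b \<Longrightarrow> A \<subseteq> B \<Longrightarrow> pos A b"
  unfolding pos_def by blast

lemma pos_almost_mono:
  assumes "pos A b" "finite (b - c)"
  shows "pos A c"
  unfolding pos_def
proof (intro allI impI notI)
  fix G assume G: "finite G" "G \<subseteq> A" "finite (c - \<Union>G)"
  have "b - \<Union>G \<subseteq> (c - \<Union>G) \<union> (b - c)"
    by blast
  then show False
    using assms G unfolding pos_def by (meson finite_UnI finite_subset)
qed

lemma pos_mono: "pos A b \<Longrightarrow> b \<subseteq> c \<Longrightarrow> pos A c"
  by (rule pos_almost_mono) (auto simp: Diff_eq_empty_iff[THEN iffD2])

lemma pos_Int_or_Diff:
  assumes "pos A b"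
  shows "pos A (b \<inter> x) \<or> pos A (b - x)"
proof (rule ccontr)
  assume "\<not> ?thesis"
  then obtain G H where "finite G" "G \<subseteq> A" "finite (b \<inter> x - \<Union>G)"
      "finite H" "H \<subseteq> A" "finite (b - x - \<Union>H)"
    by (auto simp: pos_def)
  moreover have "b - \<Union>(G \<union> H) \<subseteq> (b \<inter> x - \<Union>G) \<union> (b - x - \<Union>H)"
    by blast
  ultimately have "finite (b - \<Union>(G \<union> H))" "finite (G \<union> H)" "G \<union> H \<subseteq> A"
    by (auto intro: finite_subset)
  then show False
    using assms unfolding pos_def by blast
qed

lemma pos_if_almost_disjoint:
  assumes "infinite b" "\<And>a. a \<in> A \<Longrightarrow> finite (b \<inter> a)"
  shows "pos A b"
  unfolding pos_def
proof (intro allI impI)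
  fix G assume "finite G" "G \<subseteq> A"
  then have "finite (\<Union>a\<in>G. b \<inter> a)"
    using assms by (intro finite_UN_I) auto
  then have "infinite (b - (\<Union>a\<in>G. b \<inter> a))"
    using assms(1) by (rule Diff_infinite_finite)
  moreover have "b - (\<Union>a\<in>G. b \<inter> a) = b - \<Union>G"
    by blast
  ultimately show "infinite (b - \<Union>G)"
    by simp
qed

text \<open>If finitely many members almost covered \<open>b\<close>, any further member with
  infinite trace on \<open>b\<close> would meet one of them infinitely.\<close>

lemma pos_if_infinite_traces:
  assumes A: "pairwise almost_disjoint A" and "infinite {a \<in> A. infinite (b \<inter> a)}"
  shows "pos A b"
  unfolding pos_def
proof (intro allI impI notI)
  fix G assume G: "finite G" "G \<subseteq> A" "finite (b - \<Union>G)"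
  have "\<not> {a \<in> A. infinite (b \<inter> a)} \<subseteq> G"
    using assms(2) G(1) finite_subset by blast
  then obtain a where a: "a \<in> A" "infinite (b \<inter> a)" "a \<notin> G"
    by auto
  have "finite (a \<inter> g)" if "g \<in> G" for g
  proof -
    have "a \<noteq> g" "g \<in> A"
      using a(3) that G(2) by auto
    then show ?thesis
      using A a(1) by (auto simp: pairwise_def almost_disjoint_def)
  qed
  then have "finite ((b - \<Union>G) \<union> (\<Union>g\<in>G. a \<inter> g))"
    using G by (intro finite_UnI finite_UN_I) auto
  moreover have "b \<inter> a \<subseteq> (b - \<Union>G) \<union> (\<Union>g\<in>G. a \<inter> g)"
    by blast
  ultimately show False
    using a(2) finite_subset by blast
qed

text \<open>If only finitely many members have infinite trace on \<open>b\<close>, remove them: the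
  rest of \<open>b\<close> is almost disjoint from \<open>A\<close>, and splitting it suffices.
  Otherwise split infinitely many traces at once, so that both halves keep infinitely many infinite
  traces.\<close>

lemma pos_splits:
  assumes F: "omega_splitting F" and A: "pairwise almost_disjoint A" and b: "pos A b"
  shows "\<exists>x\<in>F. pos A (b \<inter> x) \<and> pos A (b - x)"
proof (cases "finite {a \<in> A. infinite (b \<inter> a)}")
  case True
  define d where "d = b - \<Union>{a \<in> A. infinite (b \<inter> a)}"
  have "infinite d"
    using b True unfolding pos_def d_def by blast
  then obtain x where x: "x \<in> F" "splits x d"
    using F[unfolded omega_splitting_def, rule_format, of "\<lambda>_. d"] by blast
  have fin: "finite (d \<inter> a)" if "a \<in> A" for a
  proof (cases "infinite (b \<inter> a)")
    case True
    then have "d \<inter> a = {}"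
      using that by (auto simp: d_def)
    then show ?thesis
      by simp
  next
    case False
    moreover have "d \<inter> a \<subseteq> b \<inter> a"
      by (auto simp: d_def)
    ultimately show ?thesis
      using finite_subset by blast
  qed
  have "pos A (d \<inter> x)" "pos A (d - x)"
    using x(2) fin unfolding splits_def
    by (auto intro!: pos_if_almost_disjoint intro: finite_subset[OF _ fin])
  then show ?thesis
    using x(1) by (metis (no_types, lifting) Diff_mono Diff_subset Int_mono d_def pos_mono subset_refl)
next
  case False
  then obtain c :: "nat \<Rightarrow> nat set" where c: "inj c" "range c \<subseteq> {a \<in> A. infinite (b \<inter> a)}"
    using infinite_countable_subset by blast
  then have "infinite (b \<inter> c n)" for n
    by blast
  then obtain x where x: "x \<in> F" "\<And>n. splits x (b \<inter> c n)"
    using F[unfolded omega_splitting_def, rule_format, of "\<lambda>n. b \<inter> c n"] by blast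
  have "b \<inter> x \<inter> c n = b \<inter> c n \<inter> x" "(b - x) \<inter> c n = b \<inter> c n - x" for n
    by blast+
  then have "infinite (b \<inter> x \<inter> c n)" "infinite ((b - x) \<inter> c n)" for n
    using x(2)[of n] by (simp_all add: splits_def)
  then have "range c \<subseteq> {a \<in> A. infinite (b \<inter> x \<inter> a)}" "range c \<subseteq> {a \<in> A. infinite ((b - x) \<inter> a)}"
    using c(2) by blast+
  then have "infinite {a \<in> A. infinite (b \<inter> x \<inter> a)}" "infinite {a \<in> A. infinite ((b - x) \<inter> a)}"
    using range_inj_infinite[OF c(1)] finite_subset by blast+
  then show ?thesis
    using x(1) pos_if_infinite_traces[OF A] by blast
qed

lemma decreasing_pseudo_intersection:
  fixes b d :: "nat \<Rightarrow> nat set"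
  assumes dec: "antimono b" and inf: "\<And>n j. infinite (b n \<inter> d j)"
  shows "\<exists>c. c \<subseteq> b 0 \<and> (\<forall>n. finite (c - b n)) \<and> (\<forall>j. infinite (c \<inter> d j))"
proof -
  \<comment> \<open>Decoding \<open>m\<close> as a pair lets every index \<open>j\<close> recur
    infinitely often, so each \<open>d j\<close> receives infinitely many points.\<close>
  have "\<exists>k. k \<ge> m \<and> k \<in> b m \<inter> d (fst (prod_decode m))" for m
    using inf unfolding infinite_nat_iff_unbounded_le by blast
  then obtain k where k: "\<And>m. m \<le> k m" "\<And>m. k m \<in> b m" "\<And>m. k m \<in> d (fst (prod_decode m))"
    by (metis IntE)
  have sub: "b m \<subseteq> b n" if "n \<le> m" for m n
    using antimonoD[OF dec that] .
  have "range k \<subseteq> b 0"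
    using k(2) sub[of 0] by blast
  moreover have "finite (range k - b n)" for n
  proof -
    have "k m \<in> b n" if "\<not> m < n" for m
      using k(2) sub[of n m] that by auto
    then have "range k - b n \<subseteq> k ` {..<n}"
      by blast
    then show ?thesis
      using finite_subset by blast
  qed
  moreover have "infinite (range k \<inter> d j)" for j
    unfolding infinite_nat_iff_unbounded_le
  proof
    fix N
    have "N \<le> k (prod_encode (j, N))"
      using le_prod_encode_2[of N j] k(1) order_trans by blast
    then show "\<exists>n\<ge>N. n \<in> range k \<inter> d j"
      using k(3)[of "prod_encode (j, N)"] by auto
  qed
  ultimately show ?thesis
    by blast
qed

text \<open>The same dichotomy, for members that meet every \<open>b n\<close> infinitely: finitely
  many are removed first, while infinitely many are kept infinite on \<open>c\<close> by
  diagonalization.\<close>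

lemma pos_pseudo_intersection:
  fixes b :: "nat \<Rightarrow> nat set"
  assumes A: "pairwise almost_disjoint A" and dec: "antimono b" and b: "\<And>n. pos A (b n)"
  shows "\<exists>c. pos A c \<and> c \<subseteq> b 0 \<and> (\<forall>n. finite (c - b n))"
proof (cases "finite {a \<in> A. \<forall>n. infinite (b n \<inter> a)}")
  case True
  define U where "U = \<Union>{a \<in> A. \<forall>n. infinite (b n \<inter> a)}"
  have "infinite (b n - U)" for n
    using b True unfolding pos_def U_def by blast
  moreover have "antimono (\<lambda>n. b n - U)"
    using dec by (auto simp: antimono_def)
  ultimately obtain c where c: "c \<subseteq> b 0 - U" "\<And>n. finite (c - (b n - U))" "infinite c"
    using decreasing_pseudo_intersection[of "\<lambda>n. b n - U" "\<lambda>_. UNIV"] by auto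
  have "pos A c"
  proof (rule pos_if_almost_disjoint)
    fix a assume a: "a \<in> A"
    show "finite (c \<inter> a)"
    proof (cases "\<forall>n. infinite (b n \<inter> a)")
      case True
      then have "a \<subseteq> U"
        using a by (auto simp: U_def)
      then have "c \<inter> a = {}"
        using c(1) by blast
      then show ?thesis
        by simp
    next
      case False
      then obtain n where "finite (b n \<inter> a)"
        by blast
      then have "finite ((b n \<inter> a) \<union> (c - (b n - U)))"
        using c(2) by simp
      then show ?thesis
        by (rule finite_subset[rotated]) blast
    qed
  qed fact
  moreover have "finite (c - b n)" for n
    by (rule finite_subset[OF _ c(2)[of n]]) blast
  ultimately show ?thesis
    using c(1) by blast
next
  case False
  then obtain d :: "nat \<Rightarrow> nat set" where d: "inj d" "range d \<subseteq> {a \<in> A. \<forall>n. infinite (b n \<inter> a)}"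
    using infinite_countable_subset by blast
  then have "infinite (b n \<inter> d j)" for n j
    by blast
  then obtain c where c: "c \<subseteq> b 0" "\<And>n. finite (c - b n)" "\<And>j. infinite (c \<inter> d j)"
    using decreasing_pseudo_intersection[OF dec, of d] by blast
  then have "range d \<subseteq> {a \<in> A. infinite (c \<inter> a)}"
    using d(2) by blast
  then have "infinite {a \<in> A. infinite (c \<inter> a)}"
    using range_inj_infinite[OF d(1)] finite_subset by blast
  then show ?thesis
    using c pos_if_infinite_traces[OF A] by blast
qed

text \<open>Only the set \<open>H\<close> of members of \<open>G\<close> with infinite trace on
  \<open>c\<close> matters. A finite \<open>H\<close> is subtracted from \<open>c\<close>. An
  infinite \<open>H\<close>, copied to the natural numbers along the enumeration of
  \<open>c\<close>, is an a.d. family too small to be MAD, and a set extending it is copied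
  back.\<close>

lemma pos_avoid:
  assumes A: "pairwise almost_disjoint A" and c: "pos A c" and G: "G \<subseteq> A" "finite G \<or> |G| <o \<aa>"
  shows "\<exists>a\<subseteq>c. infinite a \<and> (\<forall>g\<in>G. finite (a \<inter> g))"
proof -
  define H where "H = {g \<in> G. infinite (g \<inter> c)}"
  have H: "H \<subseteq> A"
    using G(1) by (auto simp: H_def)
  have fin: "finite (c \<inter> g)" if "g \<in> G - H" for g
    using that by (auto simp: H_def Int_commute)
  have "\<exists>a\<subseteq>c. infinite a \<and> (\<forall>g\<in>H. finite (a \<inter> g))"
  proof (cases "finite H")
    case True
    have "(c - \<Union>H) \<inter> g = {}" if "g \<in> H" for g
      using that by blast
    moreover have "infinite (c - \<Union>H)"
      using c True H unfolding pos_def by blast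
    ultimately show ?thesis
      by (intro exI[of _ "c - \<Union>H"]) auto
  next
    case False
    define e where "e = enumerate c"
    have "inj e" "range e = c"
      using enumerate_in_set pos_infinite[OF c] range_enumerate
      by (auto simp: e_def strict_mono_enumerate strict_mono_imp_inj_on)
    define T where "T = (\<lambda>g. e -` g) ` H"
    have inf: "infinite (e -` g)" if "g \<in> H" for g
    proof -
      have "e ` (e -` g) = g \<inter> c"
        using \<open>range e = c\<close> by blast
      then show ?thesis
        using that by (metis (no_types, lifting) H_def finite_imageI mem_Collect_eq)
    qed
    have ad: "finite (e -` g \<inter> e -` h)" if "g \<in> H" "h \<in> H" "g \<noteq> h" for g h
      using that H A finite_vimageI[OF _ \<open>inj e\<close>, of "g \<inter> h"]
      by (auto simp: pairwise_def almost_disjoint_def)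
    have "inj_on (\<lambda>g. e -` g) H"
      using ad inf by (metis inf.idem inj_onI)
    then have "infinite T"
      unfolding T_def using False finite_imageD by blast
    have "ad_family T"
      using ad inf by (auto simp: T_def ad_family_def infinite_subsets_def pairwise_def almost_disjoint_def)
    have "|T| \<le>o |H|" "|H| \<le>o |G|"
      unfolding T_def H_def by (auto intro!: card_of_image card_of_mono1)
    moreover have "|G| <o \<aa>"
      using G(2) False finite_subset[of H G] by (auto simp: H_def)
    ultimately have "|T| <o \<aa>"
      using ordLeq_ordLess_trans by blast
    then have "\<not> mad_family T"
      using least_card(2)[of mad_family T T] not_ordLess_ordLeq by (auto simp: ad_number_def)
    then obtain B where B: "ad_family B" "T \<subset> B"
      using \<open>infinite T\<close> \<open>ad_family T\<close> by (auto simp: mad_family_def)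
    then obtain d where d: "d \<in> B" "d \<notin> T"
      by blast
    have "finite (e ` d \<inter> g)" if "g \<in> H" for g
    proof -
      have "e -` g \<in> B" "e -` g \<noteq> d"
        using that B d by (auto simp: T_def)
      then have "finite (d \<inter> e -` g)"
        using B(1) d(1) by (auto simp: ad_family_def pairwise_def almost_disjoint_def)
      moreover have "e ` d \<inter> g = e ` (d \<inter> e -` g)"
        by blast
      ultimately show ?thesis
        by simp
    qed
    moreover have "infinite (e ` d)"
      using B(1) d(1) finite_imageD[OF _ inj_on_subset[OF \<open>inj e\<close>], of d]
      by (auto simp: ad_family_def infinite_subsets_def)
    ultimately show ?thesis
      using \<open>range e = c\<close> by blast
  qed
  then obtain a where a: "a \<subseteq> c" "infinite a" "\<forall>g\<in>H. finite (a \<inter> g)"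
    by blast
  have "finite (a \<inter> g)" if "g \<in> G" for g
  proof (cases "g \<in> H")
    case False
    have "a \<inter> g \<subseteq> c \<inter> g"
      using a(1) by blast
    then show ?thesis
      using fin[of g] False that finite_subset by blast
  qed (use a(3) in blast)
  then show ?thesis
    using a by blast
qed

section \<open>Branches of positive sets and a perfect tree of them\<close>

text \<open>The well-order \<open>|F|\<close> indexes the splitting family. The function \<open>decided F A c\<close> is the branch of the
  binary tree over \<open>F\<close> along which exactly one side of \<open>c\<close> stays positive; it stops at the first
  element of \<open>F\<close> that splits \<open>c\<close> into two positive sets.\<close>

definition decided :: "nat set set \<Rightarrow> nat set set \<Rightarrow> nat set \<Rightarrow> nat set \<Rightarrow> bool option" where
  "decided F A c x = (if x \<in> F \<and> (\<forall>y\<in>under |F| x. \<not> (pos A (c \<inter> y) \<and> pos A (c - y)))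
    then Some (pos A (c \<inter> x)) else None)"

definition side :: "nat set \<Rightarrow> bool \<Rightarrow> nat set" where
  "side x t = (if t then x else - x)"

lemma under_card_of_self: "x \<in> F \<Longrightarrow> x \<in> under |F| x"
  using card_of_Well_order[of F] Field_card_of[of F]
  by (auto simp: under_def order_on_defs refl_on_def)

lemma under_card_of_subset: "under |F| x \<subseteq> F"
  using under_Field[of "|F|"] by (simp add: Field_card_of)

lemma ofilter_dom_decided: "ofilter |F| (dom (decided F A c))"
proof -
  have "trans |F|"
    using card_of_Well_order[of F] by (simp add: order_on_defs)
  then have "under |F| y \<subseteq> under |F| x" if "y \<in> under |F| x" for x y
    using that by (auto simp: under_def elim: transE)
  then show ?thesis
    using under_card_of_subset[of F]
    by (fastforce simp: ofilter_def Field_card_of decided_def dom_def)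
qed

lemma decided_SomeD: "decided F A c x = Some t \<Longrightarrow> \<not> pos A (c - side x t)"
  using under_card_of_self[of x F]
  by (auto simp: decided_def side_def Diff_eq split: if_splits)

text \<open>Shrinking cannot make both halves positive, and some half of the positive set
  \<open>c'\<close> is positive, so it is the half recorded for \<open>c\<close>. Thus
  pseudo-intersections inherit branches.\<close>

lemma decided_almost_mono:
  assumes "decided F A c x = Some t" "pos A c'" "finite (c' - c)"
  shows "decided F A c' x = Some t"
proof -
  have mono: "pos A (c \<inter> y)" if "pos A (c' \<inter> y)" for y
    using that by (rule pos_almost_mono) (rule finite_subset[OF _ assms(3)], blast)
  have mono': "pos A (c - y)" if "pos A (c' - y)" for y
    using that by (rule pos_almost_mono) (rule finite_subset[OF _ assms(3)], blast)
  have x: "x \<in> F" "\<forall>y\<in>under |F| x. \<not> (pos A (c \<inter> y) \<and> pos A (c - y))" "t = pos A (c \<inter> x)"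
    using assms(1) by (auto simp: decided_def split: if_splits)
  have "pos A (c' \<inter> x) = pos A (c \<inter> x)"
    using pos_Int_or_Diff[OF assms(2), of x] mono[of x] mono'[of x] x(2) under_card_of_self[OF x(1)]
    by blast
  moreover have "\<forall>y\<in>under |F| x. \<not> (pos A (c' \<inter> y) \<and> pos A (c' - y))"
    using x(2) mono mono' by blast
  ultimately show ?thesis
    using x(1,3) by (simp add: decided_def)
qed

text \<open>Take the first \<open>x\<close> in \<open>F\<close> with both halves of \<open>b\<close>
  positive. Earlier elements split neither half positively, and \<open>x\<close> itself leaves one
  side of each half empty.\<close>

lemma pos_splits_decided:
  assumes "omega_splitting F" "pairwise almost_disjoint A" "pos A b"
  shows "\<exists>x. pos A (b \<inter> x) \<and> pos A (b - x) \<and>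
    decided F A (b \<inter> x) x = Some True \<and> decided F A (b - x) x = Some False"
proof -
  let ?X = "{x \<in> F. pos A (b \<inter> x) \<and> pos A (b - x)}"
  have "wf ( |F| - Id)"
    using card_of_Well_order[of F] by (simp add: well_order_on_def)
  moreover have "?X \<noteq> {}"
    using pos_splits[OF assms] by blast
  ultimately obtain x where x: "x \<in> ?X" "\<And>y. (y, x) \<in> |F| - Id \<Longrightarrow> y \<notin> ?X"
    by (metis (no_types, lifting) ex_in_conv wfE_min)
  have notboth: "\<not> (pos A (b \<inter> y) \<and> pos A (b - y))" if "y \<in> under |F| x" "y \<noteq> x" for y
    using x(2)[of y] that under_card_of_subset[of F x] by (auto simp: under_def)
  have empty: "\<not> pos A {}"
    using pos_infinite by blast
  have "decided F A (b \<inter> x) x = Some (pos A (b \<inter> x \<inter> x))"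
  proof -
    have "\<not> (pos A (b \<inter> x \<inter> y) \<and> pos A (b \<inter> x - y))" if "y \<in> under |F| x" for y
    proof (cases "y = x")
      case True
      then have "b \<inter> x - y = {}"
        by blast
      then show ?thesis
        using empty by metis
    next
      case False
      then show ?thesis
        using notboth[OF that False] pos_mono[of A "b \<inter> x \<inter> y" "b \<inter> y"] pos_mono[of A "b \<inter> x - y" "b - y"]
        by blast
    qed
    then show ?thesis
      using x(1) by (auto simp: decided_def)
  qed
  moreover have "decided F A (b - x) x = Some (pos A ((b - x) \<inter> x))"
  proof -
    have "\<not> (pos A ((b - x) \<inter> y) \<and> pos A (b - x - y))" if "y \<in> under |F| x" for y
    proof (cases "y = x")
      case True
      then have "(b - x) \<inter> y = {}"
        by blast
      then show ?thesis
        using empty by metis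
    next
      case False
      then show ?thesis
        using notboth[OF that False] pos_mono[of A "(b - x) \<inter> y" "b \<inter> y"] pos_mono[of A "b - x - y" "b - y"]
        by blast
    qed
    then show ?thesis
      using x(1) by (auto simp: decided_def)
  qed
  moreover have "b \<inter> x \<inter> x = b \<inter> x" "(b - x) \<inter> x = {}"
    by blast+
  ultimately show ?thesis
    using x(1) empty by auto
qed

lemma pos_perfect_tree:
  assumes F: "omega_splitting F" and A: "pairwise almost_disjoint A" and b: "pos A b"
  shows "\<exists>C :: nat set \<Rightarrow> nat set. (\<forall>f. pos A (C f) \<and> C f \<subseteq> b) \<and>
    (\<forall>f g. f \<noteq> g \<longrightarrow> (\<exists>x t. decided F A (C f) x = Some t \<and> decided F A (C g) x = Some (\<not> t)))"
proof -
  obtain s where s: "\<And>c. pos A c \<Longrightarrow> pos A (c \<inter> s c) \<and> pos A (c - s c) \<and>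
      decided F A (c \<inter> s c) (s c) = Some True \<and> decided F A (c - s c) (s c) = Some False"
    using pos_splits_decided[OF F A] by metis
  \<comment> \<open>A set \<open>f\<close> of naturals serves as a 0-1 sequence: membership of
    \<open>n\<close> selects the half taken at level \<open>n\<close>. Two sequences share their set
    up to the first difference and are then sent to opposite sides of the same
    \<open>s (B f n)\<close>.\<close>
  define B where "B f = rec_nat b (\<lambda>n c. if n \<in> f then c \<inter> s c else c - s c)" for f
  have B_0: "B f 0 = b" and B_Suc: "B f (Suc n) = (if n \<in> f then B f n \<inter> s (B f n) else B f n - s (B f n))" for f n
    by (simp_all add: B_def)
  have pos: "pos A (B f n)" for f n
    by (induction n) (use b s in \<open>auto simp: B_0 B_Suc\<close>)
  have dec: "decided F A (B f (Suc n)) (s (B f n)) = Some (n \<in> f)" for f n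
    using s[OF pos[of f n]] by (auto simp: B_Suc)
  have "antimono (B f)" for f
    by (rule antimono_iff_le_Suc[THEN iffD2]) (auto simp: B_Suc)
  then have "\<exists>c. pos A c \<and> c \<subseteq> b \<and> (\<forall>n. finite (c - B f n))" for f
    using pos_pseudo_intersection[OF A, of "B f"] pos B_0 by metis
  then obtain C where C: "\<And>f. pos A (C f)" "\<And>f. C f \<subseteq> b" "\<And>f n. finite (C f - B f n)"
    by metis
  have decC: "decided F A (C f) (s (B f n)) = Some (n \<in> f)" for f n
    using decided_almost_mono[OF dec C(1,3)] .
  have "\<exists>x t. decided F A (C f) x = Some t \<and> decided F A (C g) x = Some (\<not> t)" if "f \<noteq> g" for f g
  proof -
    have "\<exists>n. (n \<in> f) \<noteq> (n \<in> g)"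
      using that by blast
    then obtain n where n: "(n \<in> f) \<noteq> (n \<in> g)" "\<And>m. m < n \<Longrightarrow> (m \<in> f) = (m \<in> g)"
      using exists_least_iff[of "\<lambda>n. (n \<in> f) \<noteq> (n \<in> g)"] by blast
    have "m \<le> n \<Longrightarrow> B f m = B g m" for m
      by (induction m) (use n(2) in \<open>auto simp: B_0 B_Suc\<close>)
    then have "B f n = B g n"
      by simp
    then have "decided F A (C g) (s (B f n)) = Some (\<not> n \<in> f)"
      using decC[of g n] n(1) by simp
    then show ?thesis
      using decC[of f n] by blast
  qed
  then show ?thesis
    using C by blast
qed

section \<open>Nodes and the extension of a small family by one node\<close>

text \<open>A node \<open>(a, \<sigma>)\<close> is a set \<open>a\<close> that follows the branch \<open>\<sigma>\<close>, so nodes with incomparable branches are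
  almost disjoint for free.\<close>

definition node :: "nat set set \<Rightarrow> nat set \<times> (nat set \<Rightarrow> bool option) \<Rightarrow> bool" where
  "node F p \<longleftrightarrow> infinite (fst p) \<and> ofilter |F| (dom (snd p)) \<and>
    (\<forall>x t. snd p x = Some t \<longrightarrow> finite (fst p - side x t))"

text \<open>Distinct branches are demanded so that nodes can be counted by their branches.\<close>

definition compatible :: "nat set \<times> (nat set \<Rightarrow> bool option) \<Rightarrow> nat set \<times> (nat set \<Rightarrow> bool option) \<Rightarrow> bool" where
  "compatible p q \<longleftrightarrow> finite (fst p \<inter> fst q) \<and> snd p \<noteq> snd q"

lemma ofilter_card_of_proper:
  assumes "ofilter |F| D" "D \<noteq> F"
  shows "\<exists>x\<in>F. D = underS |F| x"
  using assms wo_rel.ofilter_underS_Field[of "|F|" D] card_of_Well_order[of F]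
  by (simp add: wo_rel_def Field_card_of)

lemma card_of_ofilter_less:
  assumes "ofilter |F| D" "D \<noteq> F"
  shows "|D| <o |F|"
  using ofilter_card_of_proper[OF assms] card_of_underS[OF card_of_Card_order, of _ F]
  by (auto simp: Field_card_of)

text \<open>The first point \<open>x\<close> outside \<open>dom \<sigma>\<close> must lie in
  \<open>dom \<eta>\<close>; otherwise \<open>dom \<eta>\<close> would be contained in
  \<open>dom \<sigma>\<close> and \<open>\<eta>\<close> would be a restriction of
  \<open>\<sigma>\<close>.\<close>

lemma ofilter_restriction_underS:
  assumes "ofilter |F| (dom \<eta>)" "dom \<eta> \<noteq> F" "ofilter |F| (dom \<sigma>)" "\<sigma> \<subseteq>\<^sub>m \<eta>" "\<not> \<eta> \<subseteq>\<^sub>m \<sigma>"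
  shows "\<exists>x\<in>dom \<eta>. dom \<sigma> = underS |F| x"
proof -
  have sub: "dom \<sigma> \<subseteq> dom \<eta>" "dom \<eta> \<subseteq> F"
    using assms(1,4) by (auto simp: map_le_implies_dom_le ofilter_def Field_card_of)
  then obtain x where x: "x \<in> F" "dom \<sigma> = underS |F| x"
    using ofilter_card_of_proper[OF assms(3)] assms(2) by blast
  have "x \<in> dom \<eta>"
  proof (rule ccontr)
    assume nx: "x \<notin> dom \<eta>"
    have "dom \<eta> \<subseteq> underS |F| x"
    proof
      fix y assume y: "y \<in> dom \<eta>"
      then have "(x, y) \<notin> |F|" "x \<noteq> y"
        using nx assms(1) by (auto simp: ofilter_def under_def)
      moreover have "total_on F |F|"
        using card_of_well_order_on[of F] by (simp add: order_on_defs)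
      ultimately show "y \<in> underS |F| x"
        using y sub(2) x(1) by (auto simp: total_on_def underS_def)
    qed
    then have "\<eta> \<subseteq>\<^sub>m \<sigma>"
      using assms(4) x(2) unfolding map_le_def by (metis subsetD)
    then show False
      using assms(5) by blast
  qed
  then show ?thesis
    using x by blast
qed

text \<open>A restriction of \<open>\<eta>\<close> is determined by the point of
  \<open>dom \<eta>\<close> where it stops, and compatible nodes have different branches.\<close>

lemma card_of_restrictions:
  assumes "\<And>p. p \<in> E \<Longrightarrow> node F p" "pairwise compatible E"
    and "ofilter |F| (dom \<eta>)" "dom \<eta> \<noteq> F" "\<And>p. p \<in> E \<Longrightarrow> \<not> \<eta> \<subseteq>\<^sub>m snd p"
  shows "|{p \<in> E. snd p \<subseteq>\<^sub>m \<eta>}| \<le>o |dom \<eta>|"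
proof -
  have "\<forall>p\<in>{p \<in> E. snd p \<subseteq>\<^sub>m \<eta>}. \<exists>x. x \<in> dom \<eta> \<and> dom (snd p) = underS |F| x"
    using ofilter_restriction_underS[OF assms(3,4)] assms(1,5) by (fastforce simp: node_def)
  then obtain X where X: "\<And>p. p \<in> E \<Longrightarrow> snd p \<subseteq>\<^sub>m \<eta> \<Longrightarrow> X p \<in> dom \<eta> \<and> dom (snd p) = underS |F| (X p)"
    by (metis (mono_tags, lifting) mem_Collect_eq)
  have "inj_on X {p \<in> E. snd p \<subseteq>\<^sub>m \<eta>}"
  proof (rule inj_onI)
    fix p q assume pq: "p \<in> {p \<in> E. snd p \<subseteq>\<^sub>m \<eta>}" "q \<in> {p \<in> E. snd p \<subseteq>\<^sub>m \<eta>}" "X p = X q"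
    then have "dom (snd p) = dom (snd q)"
      using X by auto
    then have "snd p = snd q"
      using pq by (intro map_le_antisym) (auto simp: map_le_def)
    then show "p = q"
      using pq assms(2) by (auto simp: pairwise_def compatible_def)
  qed
  then show ?thesis
    using X by (intro card_of_ordLeq[THEN iffD1] exI[of _ X]) auto
qed

text \<open>The domains are comparable initial segments, so the branches disagree at a common point,
  where the two sets almost lie on opposite sides.\<close>

lemma incompatible_almost_disjoint:
  assumes "ofilter |F| (dom \<eta>)" "ofilter |F| (dom \<sigma>)" "\<not> \<eta> \<subseteq>\<^sub>m \<sigma>" "\<not> \<sigma> \<subseteq>\<^sub>m \<eta>"
    and a: "\<And>x t. \<eta> x = Some t \<Longrightarrow> finite (a - side x t)"
    and b: "\<And>x t. \<sigma> x = Some t \<Longrightarrow> finite (b - side x t)"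
  shows "finite (a \<inter> b)"
proof -
  have "dom \<eta> \<subseteq> dom \<sigma> \<or> dom \<sigma> \<subseteq> dom \<eta>"
    using wo_rel.ofilter_linord[of "|F|"] card_of_Well_order[of F] assms(1,2) by (simp add: wo_rel_def)
  then obtain x where "x \<in> dom \<eta>" "x \<in> dom \<sigma>" "\<eta> x \<noteq> \<sigma> x"
    using assms(3,4) unfolding map_le_def by (metis subsetD)
  then obtain t where "\<eta> x = Some t" "\<sigma> x = Some (\<not> t)"
    by auto
  then have "finite ((a - side x t) \<union> (b - side x (\<not> t)))"
    using a b by simp
  then show ?thesis
    by (rule finite_subset[rotated]) (auto simp: side_def)
qed

lemma compatible_almost_disjoint:
  assumes "pairwise compatible E"
  shows "pairwise almost_disjoint (fst ` E)"
  using assms by (fastforce simp: pairwise_def compatible_def almost_disjoint_def)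

text \<open>The set \<open>d\<close> makes sure that the construction never reaches a finite maximal family.\<close>

definition extension ::
  "nat set set \<Rightarrow> (nat set \<times> (nat set \<Rightarrow> bool option)) set \<Rightarrow> nat set \<Rightarrow> nat set \<times> (nat set \<Rightarrow> bool option) \<Rightarrow> bool" where
  "extension F E b p \<longleftrightarrow> fst p \<subseteq> b \<and> node F p \<and> (\<forall>q\<in>E. compatible p q) \<and>
    (\<exists>d. infinite d \<and> finite (d \<inter> fst p) \<and> (\<forall>q\<in>E. finite (d \<inter> fst q)))"

lemma extend_nodes:
  assumes F: "omega_splitting F" "|F| \<le>o \<aa>"
    and E: "\<And>p. p \<in> E \<Longrightarrow> node F p" "pairwise compatible E" "|E| <o |UNIV :: nat set set|"
    and b: "pos (fst ` E) b"
  shows "\<exists>p. extension F E b p"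
proof -
  let ?A = "fst ` E"
  note A = compatible_almost_disjoint[OF E(2)]
  obtain C where C: "\<And>f :: nat set. pos ?A (C f)" "\<And>f. C f \<subseteq> b"
    "\<And>f g. f \<noteq> g \<Longrightarrow> \<exists>x t. decided F ?A (C f) x = Some t \<and> decided F ?A (C g) x = Some (\<not> t)"
    using pos_perfect_tree[OF F(1) A b] by blast
  \<comment> \<open>No node can extend the incompatible branches of two different
    \<open>C f\<close>, so if every branch were extended by a node, \<open>E\<close> would have size
    continuum.\<close>
  have "\<exists>f. \<forall>p\<in>E. \<not> decided F ?A (C f) \<subseteq>\<^sub>m snd p"
  proof (rule ccontr)
    assume "\<not> ?thesis"
    then obtain P where P: "\<And>f. P f \<in> E" "\<And>f. decided F ?A (C f) \<subseteq>\<^sub>m snd (P f)"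
      by metis
    have "inj P"
    proof (rule injI, rule ccontr)
      fix f g assume "P f = P g" "f \<noteq> g"
      with C(3) obtain x t where xt: "decided F ?A (C f) x = Some t" "decided F ?A (C g) x = Some (\<not> t)"
        by blast
      then have "snd (P f) x = Some t" "snd (P g) x = Some (\<not> t)"
        using P(2)[of f] P(2)[of g] by (metis domI map_le_def)+
      then show False
        using \<open>P f = P g\<close> by simp
    qed
    then have "|UNIV :: nat set set| \<le>o |E|"
      using P(1) by (intro card_of_ordLeq[THEN iffD1] exI[of _ P]) auto
    then show False
      using E(3) not_ordLess_ordLeq by blast
  qed
  then obtain f where f: "\<And>p. p \<in> E \<Longrightarrow> \<not> decided F ?A (C f) \<subseteq>\<^sub>m snd p"
    by blast
  define \<eta> where "\<eta> = decided F ?A (C f)"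
  \<comment> \<open>The part of \<open>C f\<close> on the wrong side of \<open>x\<close> is not
    positive; \<open>K x\<close> almost covers it. A set almost disjoint from \<open>K x\<close> is
    therefore forced to the right side.\<close>
  have "\<exists>K. finite K \<and> K \<subseteq> ?A \<and> (\<forall>t. \<eta> x = Some t \<longrightarrow> finite (C f - side x t - \<Union>K))" for x
  proof (cases "\<eta> x")
    case (Some t)
    then have "\<not> pos ?A (C f - side x t)"
      unfolding \<eta>_def by (rule decided_SomeD)
    then show ?thesis
      using Some by (auto simp: pos_def)
  qed auto
  then obtain K where K: "\<And>x. finite (K x)" "\<And>x. K x \<subseteq> ?A"
    "\<And>x t. \<eta> x = Some t \<Longrightarrow> finite (C f - side x t - \<Union>(K x))"
    by metis
  have of\<eta>: "ofilter |F| (dom \<eta>)"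
    unfolding \<eta>_def by (rule ofilter_dom_decided)
  have "dom \<eta> \<noteq> F"
  proof -
    obtain x where "x \<in> F" "pos ?A (C f \<inter> x)" "pos ?A (C f - x)"
      using pos_splits[OF F(1) A C(1)[of f]] by blast
    then show ?thesis
      using under_card_of_self[of x F] by (auto simp: \<eta>_def decided_def dom_def)
  qed
  define R where "R = {p \<in> E. snd p \<subseteq>\<^sub>m \<eta>}"
  have R: "|R| \<le>o |dom \<eta>|"
    unfolding R_def using E(1,2) of\<eta> \<open>dom \<eta> \<noteq> F\<close> f by (intro card_of_restrictions) (auto simp: \<eta>_def)
  \<comment> \<open>Avoiding \<open>G\<close> secures both the branch \<open>\<eta>\<close> and
    almost disjointness from the nodes in \<open>R\<close>. Since \<open>\<eta>\<close> stops before
    exhausting \<open>F\<close>, \<open>G\<close> is finite or smaller than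
    \<open>\<aa>\<close>.\<close>
  define G where "G = (\<Union>x\<in>dom \<eta>. K x) \<union> fst ` R"
  have "G \<subseteq> ?A"
    using K(2) by (auto simp: G_def R_def)
  moreover have "finite G \<or> |G| <o \<aa>"
  proof (cases "finite (dom \<eta>)")
    case True
    then show ?thesis
      using K(1) card_of_ordLeq_finite[OF R] by (simp add: G_def)
  next
    case False
    have "|fst ` R| \<le>o |dom \<eta>|"
      using card_of_image R ordLeq_transitive by blast
    moreover have "|K x| \<le>o |dom \<eta>|" for x
      using False K(1) card_of_Well_order
      by (intro ordLess_imp_ordLeq finite_ordLess_infinite) (simp_all only: Field_card_of not_False_eq_True)
    then have "|\<Union>x\<in>dom \<eta>. K x| \<le>o |dom \<eta>|"
      using False by (intro card_of_UNION_ordLeq_infinite ballI ordLeq_refl card_of_Card_order)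
    ultimately have "|G| \<le>o |dom \<eta>|"
      unfolding G_def using False by (intro card_of_Un_ordLeq_infinite_Field) (auto simp: Field_card_of card_of_card_order_on)
    then show ?thesis
      using card_of_ofilter_less[OF of\<eta> \<open>dom \<eta> \<noteq> F\<close>] F(2) ordLeq_ordLess_trans ordLess_ordLeq_trans
      by blast
  qed
  ultimately obtain a' where a': "a' \<subseteq> C f" "infinite a'" "\<And>g. g \<in> G \<Longrightarrow> finite (a' \<inter> g)"
    using pos_avoid[OF A C(1)[of f], of G] by blast
  have side: "finite (a' - side x t)" if "\<eta> x = Some t" for x t
  proof -
    have "finite (\<Union>g\<in>K x. a' \<inter> g)"
      using that K(1) by (intro finite_UN_I a') (auto simp: G_def)
    then have "finite ((C f - side x t - \<Union>(K x)) \<union> (\<Union>g\<in>K x. a' \<inter> g))"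
      using K(3)[OF that] by simp
    then show ?thesis
      by (rule finite_subset[rotated]) (use a'(1) in auto)
  qed
  have ad: "finite (a' \<inter> fst p)" if p: "p \<in> E" for p
  proof (cases "p \<in> R")
    case True
    then show ?thesis
      by (intro a') (auto simp: G_def)
  next
    case False
    then show ?thesis
      using E(1)[OF p] f[OF p] p side of\<eta>
      by (intro incompatible_almost_disjoint[of F \<eta> "snd p"]) (auto simp: R_def node_def \<eta>_def)
  qed
  \<comment> \<open>One half of \<open>a'\<close> becomes the new set; the other is the reserve
    \<open>d\<close> required by \<open>extension\<close>.\<close>
  obtain y where y: "splits y a'"
    using splitting_family_Pow a'(2) by (auto simp: splitting_family_def infinite_subsets_def)
  have "node F (a' \<inter> y, \<eta>)"
    using y of\<eta> side by (auto simp: node_def splits_def intro: finite_subset[OF _ side])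
  moreover have "compatible (a' \<inter> y, \<eta>) q" if "q \<in> E" for q
    using f[OF that] ad[OF that] by (auto simp: compatible_def \<eta>_def intro: finite_subset[OF _ ad[OF that]])
  moreover have "infinite (a' - y)" "(a' - y) \<inter> (a' \<inter> y) = {}"
    using y by (auto simp: splits_def)
  moreover have "finite ((a' - y) \<inter> fst q)" if "q \<in> E" for q
    using ad[OF that] by (rule finite_subset[rotated]) blast
  moreover have "a' \<inter> y \<subseteq> b"
    using a'(1) C(2) by blast
  ultimately show ?thesis
    unfolding extension_def by (intro exI[of _ "(a' \<inter> y, \<eta>)"] conjI exI[of _ "a' - y"]) auto
qed

section \<open>The recursion of length continuum\<close>

abbreviation preds :: "'a \<Rightarrow> 'a set" where
  "preds \<equiv> underS (card_of UNIV)"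

text \<open>The stages of the recursion are the sets \<open>b\<close> of natural numbers themselves, in the well-order
  \<open>|UNIV|\<close>; stage \<open>b\<close> adds a subset of \<open>b\<close>, or nothing if \<open>b\<close> is no longer positive.\<close>

definition earlier :: "(nat set \<Rightarrow> 'a option) \<Rightarrow> nat set \<Rightarrow> 'a set" where
  "earlier H b = {p. \<exists>y\<in>preds b. H y = Some p}"

definition step ::
  "nat set set \<Rightarrow> (nat set \<Rightarrow> (nat set \<times> (nat set \<Rightarrow> bool option)) option) \<Rightarrow> nat set \<Rightarrow>
    (nat set \<times> (nat set \<Rightarrow> bool option)) option \<Rightarrow> bool" where
  "step F H b r \<longleftrightarrow> (if pos (fst ` earlier H b) b
    then \<exists>p. r = Some p \<and> extension F (earlier H b) b p else r = None)"

lemma step_SomeD: "step F H b (Some p) \<Longrightarrow> extension F (earlier H b) b p"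
  by (auto simp: step_def split: if_splits)

lemma preds_total: "y = z \<or> y \<in> preds z \<or> z \<in> preds y"
proof -
  have "total_on UNIV |UNIV :: 'a set|"
    using card_of_well_order_on[of "UNIV :: 'a set"] by (simp add: order_on_defs)
  then show ?thesis
    by (auto simp: total_on_def underS_def)
qed

lemma finite_has_last:
  assumes "finite D" "D \<noteq> {}"
  shows "\<exists>m\<in>D. \<forall>y\<in>D. y = m \<or> y \<in> preds m"
proof -
  have "trans |UNIV :: 'a set|"
    using card_of_Well_order[of "UNIV :: 'a set"] by (simp add: order_on_defs)
  then have trans: "y = m' \<or> y \<in> preds m'"
    if "y \<in> preds m" "m \<in> preds m'" for y m m' :: 'a
    using that by (auto simp: underS_def elim: transE)
  show ?thesis
    using assms
  proof (induction rule: finite_ne_induct)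
    case (insert x D)
    then obtain m where m: "m \<in> D" "\<And>y. y \<in> D \<Longrightarrow> y = m \<or> y \<in> preds m"
      by blast
    show ?case
    proof (cases "m \<in> preds x")
      case True
      then have "y = x \<or> y \<in> preds x" if "y \<in> D" for y
        using m(2)[OF that] trans by blast
      then show ?thesis
        by (intro bexI[of _ x]) auto
    next
      case False
      then have "x = m \<or> x \<in> preds m"
        using preds_total[of x m] by blast
      then show ?thesis
        using m by (intro bexI[of _ m]) auto
    qed
  qed simp
qed

text \<open>Of two stages, the later one chose its node compatible with the earlier. The case
  \<open>D = preds b\<close> serves the recursion, \<open>D = UNIV\<close> the final family.\<close>

lemma steps_pairwise_compatible:
  assumes "\<And>y. y \<in> D \<Longrightarrow> step F H y (H y)"
  shows "pairwise compatible {p. \<exists>y\<in>D. H y = Some p}"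
proof -
  have *: "compatible q p" if "z \<in> D" "H y = Some p" "H z = Some q" "y \<in> preds z" for y z p q
  proof -
    have "extension F (earlier H z) z q"
      using assms[OF that(1)] that(3) by (simp add: step_SomeD)
    moreover have "p \<in> earlier H z"
      using that(2,4) by (auto simp: earlier_def)
    ultimately show ?thesis
      by (simp add: extension_def)
  qed
  have sym: "compatible p q" if "compatible q p" for p q
    using that by (auto simp: compatible_def Int_commute)
  show ?thesis
  proof (rule pairwiseI)
    fix p q assume "p \<in> {p. \<exists>y\<in>D. H y = Some p}" "q \<in> {p. \<exists>y\<in>D. H y = Some p}" "p \<noteq> q"
    then obtain y z where yz: "y \<in> D" "z \<in> D" "H y = Some p" "H z = Some q"
      by blast
    then have "y \<noteq> z"
      using \<open>p \<noteq> q\<close> by auto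
    with yz show "compatible p q"
      using preds_total[of y z] *[of z y p q] *[of y z q p] sym by blast
  qed
qed

lemma steps_exist:
  assumes F: "omega_splitting F" "|F| \<le>o \<aa>"
  shows "\<exists>H. \<forall>b. step F H b (H b)"
proof (rule dependent_wf_choice)
  show "wf ( |UNIV :: nat set set| - Id)"
    using card_of_Well_order[of "UNIV :: nat set set"] by (simp add: well_order_on_def)
next
  fix f g :: "nat set \<Rightarrow> (nat set \<times> (nat set \<Rightarrow> bool option)) option" and b r
  assume "\<And>z. (z, b) \<in> |UNIV| - Id \<Longrightarrow> f z = g z"
  then have "earlier f b = earlier g b"
    by (auto simp: earlier_def underS_def)
  then show "step F f b r = step F g b r"
    by (simp add: step_def)
next
  fix b :: "nat set" and H
  assume "\<And>y. (y, b) \<in> |UNIV| - Id \<Longrightarrow> step F H y (H y)"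
  then have H: "step F H y (H y)" if "y \<in> preds b" for y
    using that by (auto simp: underS_def)
  have node: "node F p" if p: "p \<in> earlier H b" for p
  proof -
    obtain y where "y \<in> preds b" "H y = Some p"
      using p by (auto simp: earlier_def)
    then show ?thesis
      using H[of y] step_SomeD[of F H y p] by (simp add: extension_def)
  qed
  have "pairwise compatible (earlier H b)"
    unfolding earlier_def using H by (rule steps_pairwise_compatible)
  \<comment> \<open>Each stage adds at most one node, and proper initial segments of a cardinal
    order are smaller than its field.\<close>
  moreover have "|earlier H b| <o |UNIV :: nat set set|"
  proof -
    have "earlier H b \<subseteq> (the \<circ> H) ` preds b"
      by (force simp: earlier_def)
    then have "|earlier H b| \<le>o |preds b|"
      using card_of_mono1 card_of_image ordLeq_transitive by blast
    moreover have "|preds b| <o |UNIV :: nat set set|"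
      by (rule card_of_underS[OF card_of_Card_order]) (simp add: Field_card_of)
    ultimately show ?thesis
      by (rule ordLeq_ordLess_trans)
  qed
  ultimately have "\<exists>p. extension F (earlier H b) b p" if "pos (fst ` earlier H b) b"
    using extend_nodes[OF F node _ _ that] by blast
  then show "\<exists>r. step F H b r"
    by (auto simp: step_def)
qed

section \<open>Complete separability and maximality of the resulting family\<close>

lemma ad_positive_pos:
  assumes "A \<noteq> {}" "b \<in> ad_positive A"
  shows "pos A b"
  unfolding pos_def
proof (intro allI impI notI)
  fix G assume G: "finite G" "G \<subseteq> A" "finite (b - \<Union>G)"
  \<comment> \<open>\<open>ad_ideal\<close> asks for a nonempty finite subfamily, so a member is
    added in case \<open>G\<close> is empty.\<close>
  obtain a where "a \<in> A"
    using assms(1) by blast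
  moreover have "finite (b - \<Union>(insert a G))"
    by (rule finite_subset[OF _ G(3)]) blast
  ultimately have "b \<in> ad_ideal A"
    using G unfolding ad_ideal_def almost_subset_def
    by (intro CollectI exI[of _ "insert a G"]) auto
  then show False
    using assms(2) by (simp add: ad_positive_def)
qed

text \<open>A new set almost disjoint from \<open>A\<close> would be positive and hence contain a
  member of \<open>A\<close>, which it then meets infinitely.\<close>

lemma mad_family_if_pos:
  assumes "infinite A" "ad_family A" "\<And>b. pos A b \<Longrightarrow> \<exists>a\<in>A. a \<subseteq> b"
  shows "mad_family A"
  unfolding mad_family_def
proof (intro conjI assms(1,2) notI)
  assume "\<exists>B. ad_family B \<and> A \<subset> B"
  then obtain B d where B: "ad_family B" "A \<subseteq> B" "d \<in> B" "d \<notin> A"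
    by blast
  have "finite (d \<inter> a)" if "a \<in> A" for a
  proof -
    have "a \<in> B" "d \<noteq> a"
      using B that by auto
    then show ?thesis
      using B(1,3) by (auto simp: ad_family_def pairwise_def almost_disjoint_def)
  qed
  moreover have "infinite d"
    using B by (auto simp: ad_family_def infinite_subsets_def)
  ultimately obtain a where "a \<in> A" "a \<subseteq> d" "finite (d \<inter> a)"
    using assms(3) pos_if_almost_disjoint by metis
  then show False
    using assms(2) by (auto simp: ad_family_def infinite_subsets_def Int_absorb1)
qed

theorem theorem10:
  assumes "\<ss> \<le>o \<aa>"
  shows "\<exists>\<A>. \<A> \<subseteq> infinite_subsets \<and> mad_family \<A> \<and> completely_separable \<A>"
proof -
  obtain F where F: "omega_splitting F" "|F| \<le>o \<aa>"
    using omega_splitting_le_ad_number[OF assms] by blast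
  obtain H where H: "\<And>b. step F H b (H b)"
    using steps_exist[OF F] by blast
  define E where "E = {p. \<exists>b. H b = Some p}"
  define A where "A = fst ` E"
  have ext: "extension F (earlier H b) b p" if "H b = Some p" for b p
    using H[of b] that by (simp add: step_SomeD)
  have compat: "pairwise compatible E"
    using steps_pairwise_compatible[of UNIV F H] H by (simp add: E_def)
  have infA: "infinite a" if "a \<in> A" for a
    using that ext by (auto simp: A_def E_def extension_def node_def)
  have ad: "ad_family A"
    using infA compatible_almost_disjoint[OF compat]
    by (auto simp: ad_family_def infinite_subsets_def A_def)
  \<comment> \<open>Positivity passes down to the family present at stage \<open>b\<close>, so that
    stage added a subset of \<open>b\<close>.\<close>
  have sep: "\<exists>a\<in>A. a \<subseteq> b" if "pos A b" for b
  proof -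
    have "earlier H b \<subseteq> E"
      by (auto simp: earlier_def E_def)
    then have "pos (fst ` earlier H b) b"
      using that by (auto simp: A_def intro: pos_antimono)
    then obtain p where "H b = Some p"
      using H[of b] by (auto simp: step_def)
    then have "fst p \<subseteq> b" "fst p \<in> A"
      using ext[of b p] by (auto simp: A_def E_def extension_def)
    then show ?thesis
      by blast
  qed
  have "pos {} UNIV"
    by (rule pos_if_almost_disjoint) auto
  then have "A \<noteq> {}"
    using sep by blast
  have "infinite A"
  proof
    assume "finite A"
    have "\<forall>a\<in>A. \<exists>b. \<exists>p. H b = Some p \<and> fst p = a"
      unfolding A_def E_def by blast
    then obtain g where g: "\<And>a. a \<in> A \<Longrightarrow> \<exists>p. H (g a) = Some p \<and> fst p = a"
      using bchoice by metis
    \<comment> \<open>The reserve \<open>d\<close> of the last stage \<open>m\<close> is almost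
      disjoint from all of \<open>A\<close>, hence positive, yet it would have to contain a member
      of \<open>A\<close>.\<close>
    obtain m where m: "m \<in> g ` A" "\<And>y. y \<in> g ` A \<Longrightarrow> y = m \<or> y \<in> preds m"
      using finite_has_last[of "g ` A"] \<open>finite A\<close> \<open>A \<noteq> {}\<close> by auto
    then obtain p where p: "H m = Some p"
      using g by blast
    obtain d where d: "infinite d" "finite (d \<inter> fst p)" "\<And>q. q \<in> earlier H m \<Longrightarrow> finite (d \<inter> fst q)"
      using ext[OF p] by (auto simp: extension_def)
    have fin: "finite (d \<inter> a)" if "a \<in> A" for a
    proof -
      obtain q where "H (g a) = Some q" "fst q = a"
        using g[OF \<open>a \<in> A\<close>] by blast
      moreover have "q = p \<or> q \<in> earlier H m"
        using m(2)[of "g a"] that calculation p by (auto simp: earlier_def)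
      ultimately show ?thesis
        using d by blast
    qed
    then obtain a where "a \<in> A" "a \<subseteq> d"
      using sep pos_if_almost_disjoint d(1) by metis
    then show False
      using fin infA by (metis inf.absorb2)
  qed
  then have "mad_family A"
    using ad sep by (rule mad_family_if_pos)
  moreover have "completely_separable A"
    using ad sep ad_positive_pos[OF \<open>A \<noteq> {}\<close>] by (auto simp: completely_separable_def)
  ultimately show ?thesis
    using ad by (auto simp: ad_family_def)
qed

end
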